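(* Let $G$ be a connected locally finite graph. Every connected subgraph $H\subseteq G$ with $E(H)\subseteq E_{\mathrm{tl}}(G)$ satisfies $$\mathrm{DN}_{\mathrm{LLY}}(H)\le \mathrm{DN}_{\mathrm{LLY}}(G).$$
   Context: Graphs are simple and undirected, possibly infinite. Let $d(\cdot,\cdot)$ be the combinatorial distance of the graph under consideration (for $H$, the distance in $H$). For a positive edge weight $w:E\to(0,\infty)$ put $d_x^w:=\sum_{y\sim x}w_{xy}$. For $\alpha\in[0,1]$ let $\mu_x^{\alpha,w}$ be the probability measure with $\mu_x^{\alpha,w}(x)=\alpha$, $\mu_x^{\alpha,w}(z)=(1-\alpha)w_{xz}/d_x^w$ for $z\sim x$, and $0$ otherwise. Let $W_1$ be the $1$-Wasserstein distance with respect to $d$. For $x\sim y$ let $\kappa_\alpha^w(x,y):=1-W_1(\mu_x^{\alpha,w},\mu_y^{\alpha,w})$ and define the weighted Lin--Lu--Yau curvature $\kappa_{\mathrm{LLY}}^w(x,y):=\lim_{\alpha\to1^-}\kappa_\alpha^w(x,y)/(1-\alpha)$. For connected locally finite $G$ with $E\neq\varnothing$: $\mathrm{Dist}(w):=\sup_{e\in E}w_e/\inf_{e\in E}w_e$, with value $+\infty$ if the supremum is infinite or the infimum is $0$; a positive weight $w$ is admissible if $\kappa_{\mathrm{LLY}}^w(e)\ge0$ for every $e\in E$; and $\mathrm{DN}_{\mathrm{LLY}}(G):=\inf\{\mathrm{Dist}(w): w \text{ admissible}\}$, with value $+\infty$ if no admissible weight has finite distortion. By convention $\mathrm{DN}_{\mathrm{LLY}}(K_1)=1$.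 $E_{\mathrm{tl}}(G)$ is the set of tree-like edges of $G$, i.e. edges lying on no cycle of $G$ of length $3$, $4$ or $5$. *)

theory Defs
  imports "HOL-Probability.Probability"
begin

section \<open>Simple undirected graphs, possibly infinite\<close>

record 'a ugraph =
  verts :: "'a set"
  edges :: "'a set set"

definition simple_graph :: "'a ugraph \<Rightarrow> bool" where
  "simple_graph G \<longleftrightarrow> (\<forall>e\<in>edges G. e \<subseteq> verts G \<and> card e = 2)"

definition subgraph :: "'a ugraph \<Rightarrow> 'a ugraph \<Rightarrow> bool" where
  "subgraph H G \<longleftrightarrow> simple_graph H \<and> verts H \<subseteq> verts G \<and> edges H \<subseteq> edges G"

definition neighbours :: "'a ugraph \<Rightarrow> 'a \<Rightarrow> 'a set" where
  "neighbours G x = {y. {x, y} \<in> edges G}"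

definition adj_rel :: "'a ugraph \<Rightarrow> ('a \<times> 'a) set" where
  "adj_rel G = {(x, y). {x, y} \<in> edges G}"

definition locally_finite :: "'a ugraph \<Rightarrow> bool" where
  "locally_finite G \<longleftrightarrow> (\<forall>x\<in>verts G. finite (neighbours G x))"

definition connected_graph :: "'a ugraph \<Rightarrow> bool" where
  "connected_graph G \<longleftrightarrow> verts G \<noteq> {} \<and> (\<forall>x\<in>verts G. \<forall>y\<in>verts G. (x, y) \<in> (adj_rel G)\<^sup>*)"

text \<open>Least length of a walk from \<open>x\<close> to \<open>y\<close>; only meaningful if such a walk exists.\<close>

definition graph_dist :: "'a ugraph \<Rightarrow> 'a \<Rightarrow> 'a \<Rightarrow> nat" where
  "graph_dist G x y = (LEAST n. (x, y) \<in> adj_rel G ^^ n)"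

text \<open>A cycle is given by the list of its vertices, without repeating the first one at the end.\<close>

definition cycle_edges :: "'a list \<Rightarrow> 'a set set" where
  "cycle_edges c = {{c ! i, c ! (Suc i mod length c)} | i. i < length c}"

definition is_cycle :: "'a ugraph \<Rightarrow> 'a list \<Rightarrow> bool" where
  "is_cycle G c \<longleftrightarrow> 3 \<le> length c \<and> distinct c \<and> cycle_edges c \<subseteq> edges G"

definition treelike_edges :: "'a ugraph \<Rightarrow> 'a set set" where
  "treelike_edges G =
    {e \<in> edges G. \<not> (\<exists>c. is_cycle G c \<and> length c \<in> {3, 4, 5} \<and> e \<in> cycle_edges c)}"

section \<open>Weighted Lin--Lu--Yau curvature\<close>

text \<open>A weight is a function on all two-element sets of vertices, of which only the values on
  edges are ever used.\<close>

definition wdeg :: "'a ugraph \<Rightarrow> ('a set \<Rightarrow> real) \<Rightarrow> 'a \<Rightarrow> real" where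
  "wdeg G w x = (\<Sum>y\<in>neighbours G x. w {x, y})"

text \<open>The mass function below is a genuine one whenever \<open>0 \<le> \<alpha> \<le> 1\<close>, the weight is positive and
  \<open>x\<close> has finitely many, but at least one, neighbours.\<close>

definition walk_pmf :: "'a ugraph \<Rightarrow> ('a set \<Rightarrow> real) \<Rightarrow> real \<Rightarrow> 'a \<Rightarrow> 'a pmf" where
  "walk_pmf G w \<alpha> x = embed_pmf (\<lambda>z.
     if z = x then \<alpha>
     else if z \<in> neighbours G x then (1 - \<alpha>) * w {x, z} / wdeg G w x
     else 0)"

definition couplings :: "'a pmf \<Rightarrow> 'a pmf \<Rightarrow> ('a \<times> 'a) pmf set" where
  "couplings \<mu> \<nu> = {\<pi>. map_pmf fst \<pi> = \<mu> \<and> map_pmf snd \<pi> = \<nu>}"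

text \<open>This is applied to finitely supported measures only, so every coupling has finite support
  and all the expectations exist.\<close>

definition wasserstein1 :: "'a ugraph \<Rightarrow> 'a pmf \<Rightarrow> 'a pmf \<Rightarrow> real" where
  "wasserstein1 G \<mu> \<nu> =
    (INF \<pi>\<in>couplings \<mu> \<nu>. measure_pmf.expectation \<pi> (\<lambda>(u, v). real (graph_dist G u v)))"

definition alpha_curvature ::
    "'a ugraph \<Rightarrow> ('a set \<Rightarrow> real) \<Rightarrow> real \<Rightarrow> 'a \<Rightarrow> 'a \<Rightarrow> real" where
  "alpha_curvature G w \<alpha> x y = 1 - wasserstein1 G (walk_pmf G w \<alpha> x) (walk_pmf G w \<alpha> y)"

definition lly_curvature :: "'a ugraph \<Rightarrow> ('a set \<Rightarrow> real) \<Rightarrow> 'a \<Rightarrow> 'a \<Rightarrow> real" where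
  "lly_curvature G w x y = Lim (at_left 1) (\<lambda>\<alpha>. alpha_curvature G w \<alpha> x y / (1 - \<alpha>))"

section \<open>Distortion\<close>

definition positive_weight :: "'a ugraph \<Rightarrow> ('a set \<Rightarrow> real) \<Rightarrow> bool" where
  "positive_weight G w \<longleftrightarrow> (\<forall>e\<in>edges G. 0 < w e)"

definition admissible :: "'a ugraph \<Rightarrow> ('a set \<Rightarrow> real) \<Rightarrow> bool" where
  "admissible G w \<longleftrightarrow>
    positive_weight G w \<and> (\<forall>x y. {x, y} \<in> edges G \<longrightarrow> 0 \<le> lly_curvature G w x y)"

definition distortion :: "'a ugraph \<Rightarrow> ('a set \<Rightarrow> real) \<Rightarrow> ereal" where
  "distortion G w =
    (let S = (SUP e\<in>edges G. ereal (w e)); I = (INF e\<in>edges G. ereal (w e))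
     in if S = \<infinity> \<or> I = 0 then \<infinity> else S / I)"

text \<open>A connected graph without edges is \<open>K\<^sub>1\<close>, where the value is \<open>1\<close> by convention. In
  the other case the infimum is \<open>\<infinity>\<close> if there is no admissible weight of finite distortion,
  in particular if there is no admissible weight at all.\<close>

definition DN_LLY :: "'a ugraph \<Rightarrow> ereal" where
  "DN_LLY G = (if edges G = {} then 1 else Inf {distortion G w | w. admissible G w})"

end

theory Submission imports Defs begin

text \<open>Around a tree-like edge \<open>xy\<close> the distances between the neighbours of \<open>x\<close> and of \<open>y\<close> are those of
  a tree, so an explicit potential and any coupling which never moves mass from \<open>y\<close> to \<open>x\<close> are
  optimal. This gives \<open>2 (w\<^sub>x\<^sub>y / d\<^sub>x + w\<^sub>x\<^sub>y / d\<^sub>y - 1)\<close> for the curvature of \<open>xy\<close>. Passing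
  to a subgraph only decreases the weighted degrees, hence it increases the curvature, and the
  restriction of an admissible weight is admissible, with no larger distortion.\<close>

section \<open>Couplings\<close>

lemma set_pmf_coupling:
  assumes "\<pi> \<in> couplings \<mu> \<nu>"
  shows "set_pmf \<pi> \<subseteq> set_pmf \<mu> \<times> set_pmf \<nu>"
  using assms by (force simp: couplings_def)

text \<open>The marginals of \<open>\<pi>\<close> determine the two expectations separately; finite
  support makes both integrable, so linearity applies.\<close>

lemma expectation_coupling_diff:
  fixes f :: "'a \<Rightarrow> real"
  assumes "finite (set_pmf \<mu>)" "finite (set_pmf \<nu>)" "\<pi> \<in> couplings \<mu> \<nu>"
  shows "measure_pmf.expectation \<pi> (\<lambda>(u, v). f u - f v)
    = measure_pmf.expectation \<mu> f - measure_pmf.expectation \<nu> f"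
proof -
  have fin: "finite (set_pmf \<pi>)"
    using set_pmf_coupling[OF assms(3)] assms(1,2) finite_subset by blast
  have "\<mu> = map_pmf fst \<pi>" "\<nu> = map_pmf snd \<pi>"
    using assms(3) by (auto simp: couplings_def)
  then show ?thesis
    using fin by (simp add: case_prod_unfold integrable_measure_pmf_finite)
qed

text \<open>The easy half of Kantorovich duality.\<close>

lemma wasserstein1_eqI:
  fixes f :: "'a \<Rightarrow> real"
  assumes "finite (set_pmf \<mu>)" "finite (set_pmf \<nu>)"
    and lip: "\<And>u v. u \<in> set_pmf \<mu> \<Longrightarrow> v \<in> set_pmf \<nu> \<Longrightarrow> f u - f v \<le> graph_dist G u v"
    and \<pi>: "\<pi> \<in> couplings \<mu> \<nu>"
    and tight: "\<And>u v. (u, v) \<in> set_pmf \<pi> \<Longrightarrow> graph_dist G u v = f u - f v"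
  shows "wasserstein1 G \<mu> \<nu> = measure_pmf.expectation \<mu> f - measure_pmf.expectation \<nu> f"
proof -
  let ?E = "\<lambda>\<rho>. measure_pmf.expectation \<rho> (\<lambda>(u, v). real (graph_dist G u v))"
  \<comment> \<open>Tightness holds on the support of \<open>\<pi>\<close>, so its transport cost is
    exactly the gap of the potential \<open>f\<close>, which bounds the cost of every other coupling
    from below.\<close>
  have "?E \<pi> = measure_pmf.expectation \<pi> (\<lambda>(u, v). f u - f v)"
    by (intro integral_cong_AE) (auto simp: AE_measure_pmf_iff tight)
  then have E: "?E \<pi> = measure_pmf.expectation \<mu> f - measure_pmf.expectation \<nu> f"
    using expectation_coupling_diff[OF assms(1,2) \<pi>] by simp
  have "?E \<pi> \<le> ?E \<rho>" if \<rho>: "\<rho> \<in> couplings \<mu> \<nu>" for \<rho>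
  proof -
    have "finite (set_pmf \<rho>)"
      using set_pmf_coupling[OF \<rho>] assms(1,2) finite_subset by blast
    then have "measure_pmf.expectation \<rho> (\<lambda>(u, v). f u - f v) \<le> ?E \<rho>"
      using set_pmf_coupling[OF \<rho>] lip
      by (intro integral_mono_AE) (auto simp: AE_measure_pmf_iff integrable_measure_pmf_finite)
    then show ?thesis
      using E expectation_coupling_diff[OF assms(1,2) \<rho>] by simp
  qed
  then have "wasserstein1 G \<mu> \<nu> = ?E \<pi>"
    unfolding wasserstein1_def using \<pi> by (intro cInf_eq_minimum) auto
  then show ?thesis using E by simp
qed

text \<open>Keep the mass of \<open>\<mu>\<close> at \<open>y\<close> in place and couple the remainders independently.\<close>

lemma coupling_fixing_point:
  assumes le: "pmf \<mu> y \<le> pmf \<nu> y" and less: "pmf \<mu> y < 1"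
  obtains \<pi> where "\<pi> \<in> couplings \<mu> \<nu>" "\<And>v. (y, v) \<in> set_pmf \<pi> \<Longrightarrow> v = y"
proof -
  define t where "t = pmf \<mu> y"
  have t: "0 \<le> t" "t < 1" using less by (auto simp: t_def)
  \<comment> \<open>What is left of \<open>\<nu>\<close> after removing mass \<open>t\<close> at
    \<open>y\<close>, rescaled to total mass one. \<open>le\<close> makes it nonnegative at
    \<open>y\<close>, and \<open>less\<close> makes the rescaling possible.\<close>
  define g where "g z = (pmf \<nu> z - t * pmf (return_pmf y) z) / (1 - t)" for z
  define \<nu>' where "\<nu>' = embed_pmf g"
  have int: "integrable (count_space UNIV) g"
    unfolding g_def
    by (intro Bochner_Integration.integrable_divide_zero Bochner_Integration.integrable_diff
        Bochner_Integration.integrable_mult_right integrable_pmf)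
  have nonneg: "g z \<ge> 0" for z
    using t le by (auto simp: g_def t_def pmf_return indicator_def)
  have "(\<integral>\<^sup>+ z. ennreal (g z) \<partial>count_space UNIV) = ennreal (\<integral> z. g z \<partial>count_space UNIV)"
    using nonneg by (intro nn_integral_eq_integral) (auto simp: int)
  also have "(\<integral> z. g z \<partial>count_space UNIV) = 1"
    using t unfolding g_def by (simp add: integrable_pmf integral_pmf del: pmf_return)
  finally have pmf_\<nu>': "pmf \<nu>' z = g z" for z
    unfolding \<nu>'_def by (intro pmf_embed_pmf) (auto simp: nonneg)
  define \<pi> where
    "\<pi> = bind_pmf \<mu> (\<lambda>u. if u = y then return_pmf (y, y) else map_pmf (Pair u) \<nu>')"
  have "map_pmf fst \<pi> = bind_pmf \<mu> return_pmf"
    unfolding \<pi>_def map_bind_pmf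
    by (intro bind_pmf_cong) (auto simp: map_pmf_comp map_pmf_const)
  then have fst: "map_pmf fst \<pi> = \<mu>" by (simp add: bind_return_pmf')
  have bind: "map_pmf snd \<pi> = bind_pmf \<mu> (\<lambda>u. if u = y then return_pmf y else \<nu>')"
    unfolding \<pi>_def map_bind_pmf
    by (intro bind_pmf_cong) (auto simp: map_pmf_comp)
  have int_y: "integrable (measure_pmf \<mu>) (indicator {y} :: 'a \<Rightarrow> real)"
    by (intro integrable_real_indicator) (auto simp: less_top[symmetric])
  have "pmf (map_pmf snd \<pi>) z = pmf \<nu> z" for z
  proof -
    \<comment> \<open>The second marginal is the mixture of the point mass at \<open>y\<close> with
      weight \<open>t\<close> and of \<open>\<nu>'\<close> with weight \<open>1 - t\<close>. The
      indicator form lets linearity compute it.\<close>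
    have "pmf (map_pmf snd \<pi>) z = measure_pmf.expectation \<mu>
        (\<lambda>u. pmf \<nu>' z + (pmf (return_pmf y) z - pmf \<nu>' z) * indicator {y} u)"
      unfolding bind pmf_bind by (intro Bochner_Integration.integral_cong) (auto simp: indicator_def)
    also have "\<dots> = pmf \<nu>' z + (pmf (return_pmf y) z - pmf \<nu>' z) * t"
      using int_y
      by (subst Bochner_Integration.integral_add) (simp_all add: t_def measure_pmf_single)
    also have "\<dots> = pmf \<nu> z"
    proof -
      have "g z * (1 - t) = pmf \<nu> z - t * pmf (return_pmf y) z"
        using t by (simp add: g_def)
      then show ?thesis by (simp add: pmf_\<nu>' algebra_simps del: pmf_return)
    qed
    finally show ?thesis .
  qed
  then have "map_pmf snd \<pi> = \<nu>" by (intro pmf_eqI)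
  with fst have "\<pi> \<in> couplings \<mu> \<nu>" by (simp add: couplings_def)
  moreover have "v = y" if "(y, v) \<in> set_pmf \<pi>" for v
    using that by (auto simp: \<pi>_def split: if_splits)
  ultimately show thesis by (rule that)
qed

section \<open>The random walk measures\<close>

lemma not_in_neighbours:
  assumes "simple_graph G"
  shows "x \<notin> neighbours G x"
  using assms by (auto simp: simple_graph_def neighbours_def)

lemma neighbours_sym: "y \<in> neighbours G x \<longleftrightarrow> x \<in> neighbours G y"
  by (simp add: neighbours_def insert_commute)

lemma finite_neighbours:
  assumes "simple_graph G" "locally_finite G"
  shows "finite (neighbours G x)"
proof (cases "neighbours G x = {}")
  case False
  then have "x \<in> verts G"
    using assms(1) by (auto simp: simple_graph_def neighbours_def)
  then show ?thesis using assms(2) by (auto simp: locally_finite_def)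
qed auto

lemma wdeg_pos:
  assumes "positive_weight G w" "finite (neighbours G x)" "y \<in> neighbours G x"
  shows "wdeg G w x > 0"
  unfolding wdeg_def using assms
  by (intro sum_pos) (auto simp: positive_weight_def neighbours_def)

text \<open>The neighbour \<open>y\<close> makes the weighted degree positive, so the prescribed
  masses sum to one and \<open>embed_pmf\<close> returns them unchanged.\<close>

lemma pmf_walk_pmf:
  assumes G: "simple_graph G" "locally_finite G" and w: "positive_weight G w"
    and \<alpha>: "0 \<le> \<alpha>" "\<alpha> \<le> 1" and y: "y \<in> neighbours G x"
  shows "pmf (walk_pmf G w \<alpha> x) z = (if z = x then \<alpha>
     else if z \<in> neighbours G x then (1 - \<alpha>) * w {x, z} / wdeg G w x else 0)"
proof -
  let ?N = "neighbours G x"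
  define f where "f z = (if z = x then \<alpha>
     else if z \<in> ?N then (1 - \<alpha>) * w {x, z} / wdeg G w x else 0)" for z
  have fin: "finite ?N" by (rule finite_neighbours[OF G])
  have deg: "wdeg G w x > 0" by (rule wdeg_pos[OF w fin y])
  have x: "x \<notin> ?N" by (rule not_in_neighbours[OF G(1)])
  have nonneg: "f z \<ge> 0" for z
    using \<alpha> deg w
    by (auto simp: f_def positive_weight_def neighbours_def less_imp_le
        intro!: divide_nonneg_pos mult_nonneg_nonneg)
  have "(\<integral>\<^sup>+ z. ennreal (f z) \<partial>count_space UNIV) = (\<Sum>z\<in>insert x ?N. ennreal (f z))"
    using fin by (intro nn_integral_count_space') (auto simp: f_def)
  also have "\<dots> = ennreal (\<Sum>z\<in>insert x ?N. f z)"
    by (intro sum_ennreal nonneg)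
  also have "(\<Sum>z\<in>insert x ?N. f z) = \<alpha> + (\<Sum>z\<in>?N. (1 - \<alpha>) * w {x, z} / wdeg G w x)"
    using fin x by (simp add: f_def) (intro sum.cong, auto)
  also have "\<dots> = 1"
    using deg unfolding sum_divide_distrib[symmetric] sum_distrib_left[symmetric]
    by (simp add: wdeg_def[symmetric])
  finally have "pmf (embed_pmf f) z = f z"
    by (intro pmf_embed_pmf) (auto simp: nonneg)
  then show ?thesis unfolding walk_pmf_def f_def .
qed

lemma set_walk_pmf:
  assumes "simple_graph G" "locally_finite G" "positive_weight G w"
    and "0 \<le> \<alpha>" "\<alpha> \<le> 1" "y \<in> neighbours G x"
  shows "set_pmf (walk_pmf G w \<alpha> x) \<subseteq> insert x (neighbours G x)"
  using pmf_walk_pmf[OF assms] by (auto simp: set_pmf_eq split: if_splits)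

lemma expectation_walk_pmf:
  fixes f :: "'a \<Rightarrow> real"
  assumes "simple_graph G" "locally_finite G" "positive_weight G w"
    and "0 \<le> \<alpha>" "\<alpha> \<le> 1" "y \<in> neighbours G x"
  shows "measure_pmf.expectation (walk_pmf G w \<alpha> x) f
    = \<alpha> * f x + (1 - \<alpha>) * (\<Sum>z\<in>neighbours G x. w {x, z} * f z) / wdeg G w x"
proof -
  let ?N = "neighbours G x"
  have fin: "finite ?N" using assms(1,2) by (rule finite_neighbours)
  have x: "x \<notin> ?N" by (rule not_in_neighbours[OF assms(1)])
  have "measure_pmf.expectation (walk_pmf G w \<alpha> x) f
      = (\<Sum>z\<in>insert x ?N. pmf (walk_pmf G w \<alpha> x) z * f z)"
    using fin set_walk_pmf[OF assms] by (subst integral_measure_pmf[of "insert x ?N"]) auto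
  also have "\<dots> = \<alpha> * f x + (\<Sum>z\<in>?N. (1 - \<alpha>) * w {x, z} / wdeg G w x * f z)"
    using fin x by (simp add: pmf_walk_pmf[OF assms]) (intro sum.cong, auto)
  also have "(\<Sum>z\<in>?N. (1 - \<alpha>) * w {x, z} / wdeg G w x * f z)
      = (1 - \<alpha>) * (\<Sum>z\<in>?N. w {x, z} * f z) / wdeg G w x"
    by (simp add: sum_distrib_left sum_divide_distrib mult.assoc)
  finally show ?thesis .
qed

section \<open>Tree-like edges\<close>

lemma graph_dist_eqI:
  assumes "(u, v) \<in> adj_rel G ^^ n" "\<And>m. m < n \<Longrightarrow> (u, v) \<notin> adj_rel G ^^ m"
  shows "graph_dist G u v = n"
  unfolding graph_dist_def using assms by (intro Least_equality) (auto simp: not_less[symmetric])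

lemma adj_rel_iff: "(u, v) \<in> adj_rel G \<longleftrightarrow> v \<in> neighbours G u"
  by (simp add: adj_rel_def neighbours_def)

lemma graph_dist_same: "graph_dist G u u = 0"
  by (rule graph_dist_eqI) auto

lemma graph_dist_1:
  assumes "v \<in> neighbours G u" "u \<noteq> v"
  shows "graph_dist G u v = 1"
  using assms by (intro graph_dist_eqI) (auto simp: adj_rel_iff)

lemma graph_dist_2:
  assumes "z \<in> neighbours G u" "v \<in> neighbours G z" "u \<noteq> v" "v \<notin> neighbours G u"
  shows "graph_dist G u v = 2"
  using assms
  by (intro graph_dist_eqI) (auto simp: adj_rel_iff numeral_2_eq_2 less_Suc_eq)

lemma graph_dist_3:
  assumes "z \<in> neighbours G u" "z' \<in> neighbours G z" "v \<in> neighbours G z'"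
    and "u \<noteq> v" "v \<notin> neighbours G u" "neighbours G u \<inter> neighbours G v = {}"
  shows "graph_dist G u v = 3"
proof (rule graph_dist_eqI)
  show "(u, v) \<in> adj_rel G ^^ 3"
    using assms(1-3) by (fastforce simp: adj_rel_iff numeral_3_eq_3)
  \<comment> \<open>The midpoint of a walk of length two would be a common neighbour of
    \<open>u\<close> and \<open>v\<close>.\<close>
  have "(u, v) \<notin> adj_rel G O adj_rel G"
    using assms(6) neighbours_sym by (fastforce simp: adj_rel_iff)
  then show "(u, v) \<notin> adj_rel G ^^ m" if "m < 3" for m
    using that assms(4,5) by (auto simp: adj_rel_iff numeral_3_eq_3 less_Suc_eq)
qed

text \<open>A short cycle of \<open>H\<close> through \<open>e\<close> is also one of
  \<open>G\<close>. Hence the curvature formula is available in \<open>H\<close> as well.\<close>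

lemma treelike_edges_subgraph:
  assumes "edges H \<subseteq> edges G" "e \<in> edges H" "e \<in> treelike_edges G"
  shows "e \<in> treelike_edges H"
  using assms unfolding treelike_edges_def is_cycle_def by blast

text \<open>Stated for one graph and one edge, so that it can be interpreted for the same edge both
  in the ambient graph and in the subgraph.\<close>

locale treelike_edge =
  fixes G :: "'a ugraph" and x y :: 'a
  assumes simple: "simple_graph G" and treelike: "{x, y} \<in> treelike_edges G"
begin

lemma edge: "y \<in> neighbours G x" "x \<in> neighbours G y"
  using treelike by (auto simp: treelike_edges_def neighbours_def insert_commute)

lemma distinct_ends: "x \<noteq> y"
  using edge not_in_neighbours[OF simple] by auto

text \<open>Normal form for the next three exclusions: the cycle is listed from \<open>x\<close>
  along the edge to \<open>y\<close>, with one, two or three further vertices.\<close>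

lemma no_short_cycle:
  assumes "is_cycle G (x # y # c)" "length c \<in> {1, 2, 3}"
  shows False
proof -
  have "{x, y} \<in> cycle_edges (x # y # c)"
    unfolding cycle_edges_def by (force intro!: exI[of _ 0])
  then show False
    using assms treelike by (auto simp: treelike_edges_def)
qed

lemma no_triangle:
  assumes "a \<in> neighbours G x" "a \<in> neighbours G y"
  shows False
proof -
  have "is_cycle G [x, y, a]"
    using assms edge distinct_ends not_in_neighbours[OF simple]
    by (auto simp: is_cycle_def cycle_edges_def neighbours_def insert_commute less_Suc_eq)
  then show False by (rule no_short_cycle) simp
qed

lemma no_square:
  assumes "a \<in> neighbours G x" "b \<in> neighbours G y" "a \<noteq> y" "b \<noteq> x"
  shows "b \<notin> neighbours G a"
proof
  assume "b \<in> neighbours G a"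
  then have "is_cycle G [x, y, b, a]"
    using assms edge distinct_ends not_in_neighbours[OF simple]
    by (auto simp: is_cycle_def cycle_edges_def neighbours_def insert_commute less_Suc_eq)
  then show False by (rule no_short_cycle) simp
qed

lemma no_pentagon:
  assumes "a \<in> neighbours G x" "b \<in> neighbours G y" "a \<noteq> y" "b \<noteq> x"
  shows "neighbours G a \<inter> neighbours G b = {}"
proof (rule ccontr)
  assume "neighbours G a \<inter> neighbours G b \<noteq> {}"
  then obtain z where z: "z \<in> neighbours G a" "z \<in> neighbours G b" by auto
  \<comment> \<open>Each coincidence would create a triangle on the edge: \<open>a = b\<close> is a
    common neighbour of \<open>x\<close> and \<open>y\<close>, \<open>z = x\<close> makes
    \<open>b\<close> one, and \<open>z = y\<close> makes \<open>a\<close> one.\<close>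
  have "a \<noteq> b" "z \<noteq> x" "z \<noteq> y"
    using no_triangle assms z neighbours_sym[of _ G] by metis+
  moreover have "a \<noteq> z" "b \<noteq> z" "a \<noteq> x" "b \<noteq> y"
    using z assms not_in_neighbours[OF simple] by auto
  ultimately have "is_cycle G [x, y, b, z, a]"
    using z assms edge distinct_ends
    by (auto simp: is_cycle_def cycle_edges_def neighbours_def insert_commute less_Suc_eq)
  then show False by (rule no_short_cycle) simp
qed

text \<open>The distance from the branch behind \<open>y\<close>, for vertices adjacent to the edge.\<close>

definition potential :: "'a \<Rightarrow> real" where
  "potential z = (if z = x then 2 else if z = y then 1 else if z \<in> neighbours G x then 3 else 0)"

text \<open>Without cycles of length 3, 4 or 5 on the edge, the branch of \<open>x\<close>, then
  \<open>x\<close>, \<open>y\<close> and the branch of \<open>y\<close> sit at heights 3, 2, 1, 0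
  and shortest paths only descend. The excluded pair \<open>u = y\<close>, \<open>v = x\<close> is
  the one that climbs: distance 1, potential difference -1.\<close>

lemma graph_dist_eq_potential_diff:
  assumes u: "u \<in> insert x (neighbours G x)" and v: "v \<in> insert y (neighbours G y)"
    and nbt: "u = y \<Longrightarrow> v \<noteq> x"
  shows "graph_dist G u v = potential u - potential v"
proof -
  note sym = neighbours_sym[of _ G]
  note irr = not_in_neighbours[OF simple]
  consider "u = y" | "u = x" | "u \<noteq> x" "u \<noteq> y" "u \<in> neighbours G x" using u by auto
  then show ?thesis
  proof cases
    case 1
    then show ?thesis
      using v nbt distinct_ends no_triangle[of v] irr
      by (cases "v = y") (auto simp: potential_def graph_dist_same graph_dist_1)
  next
    case 2
    consider "v = x" | "v = y" | "v \<noteq> x" "v \<noteq> y" "v \<in> neighbours G y" using v by auto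
    then show ?thesis
    proof cases
      case 3
      then have "v \<notin> neighbours G x" using no_triangle by blast
      with 2 3 show ?thesis
        by (auto simp: potential_def graph_dist_2[OF edge(1)])
    qed (use 2 distinct_ends edge in \<open>auto simp: potential_def graph_dist_same graph_dist_1\<close>)
  next
    case 3
    have ux: "x \<in> neighbours G u" and uy: "y \<notin> neighbours G u"
      using 3 no_triangle sym by blast+
    consider "v = x" | "v = y" | "v \<noteq> x" "v \<noteq> y" "v \<in> neighbours G y" using v by auto
    then show ?thesis
    proof cases
      case 1
      with 3 ux show ?thesis by (auto simp: potential_def graph_dist_1)
    next
      case 2
      with 3 ux uy edge distinct_ends show ?thesis
        by (auto simp: potential_def graph_dist_2)
    next
      case v: 3
      have vx: "v \<notin> neighbours G x" using v no_triangle by blast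
      then have "u \<noteq> v" using 3 by auto
      \<comment> \<open>The walk \<open>u\<close>, \<open>x\<close>, \<open>y\<close>,
        \<open>v\<close> is shortest: \<open>no_square\<close> excludes length one and
        \<open>no_pentagon\<close> length two.\<close>
      then have "graph_dist G u v = 3"
        using 3 v ux edge no_square no_pentagon by (intro graph_dist_3[of x _ _ y]) auto
      with 3 v vx show ?thesis by (auto simp: potential_def)
    qed
  qed
qed

text \<open>The potential and a coupling that keeps the mass at \<open>y\<close> in place certify
  each other as optimal, so the Wasserstein distance is a difference of two explicit expectations,
  affine in \<open>\<alpha>\<close>.\<close>

lemma lly_curvature_eq:
  assumes lf: "locally_finite G" and w: "positive_weight G w"
  shows "lly_curvature G w x y = 2 * (w {x, y} / wdeg G w x + w {x, y} / wdeg G w y - 1)"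
proof -
  define p where "p = w {x, y} / wdeg G w x"
  define q where "q = w {x, y} / wdeg G w y"
  have fin: "finite (neighbours G z)" for z by (rule finite_neighbours[OF simple lf])
  have deg: "wdeg G w x > 0" "wdeg G w y > 0"
    using wdeg_pos[OF w fin] edge by auto
  have w_pos: "w {x, y} > 0"
    using w edge by (auto simp: positive_weight_def neighbours_def)
  have p: "0 < p" "p \<le> 1"
  proof -
    have "w {x, y} \<le> wdeg G w x" unfolding wdeg_def
      using edge w fin by (intro member_le_sum[of y _ "\<lambda>z. w {x, z}"])
        (auto simp: positive_weight_def neighbours_def less_imp_le)
    then show "0 < p" "p \<le> 1" using deg w_pos by (auto simp: p_def)
  qed
  \<comment> \<open>All neighbours of \<open>x\<close> have height 3 except \<open>y\<close>, at
    height 1; the correction by 2 accounts for it.\<close>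
  have "(\<Sum>z\<in>neighbours G x. w {x, z} * potential z)
      = (\<Sum>z\<in>neighbours G x. 3 * w {x, z} - (if z = y then 2 * w {x, y} else 0))"
    using not_in_neighbours[OF simple, of x] distinct_ends
    by (intro sum.cong) (auto simp: potential_def)
  also have "\<dots> = 3 * wdeg G w x - 2 * w {x, y}"
    using edge fin by (simp add: sum_subtractf sum_distrib_left[symmetric] wdeg_def)
  finally have sum_x: "(\<Sum>z\<in>neighbours G x. w {x, z} * potential z) / wdeg G w x = 3 - 2 * p"
    using deg by (simp add: p_def field_simps)
  \<comment> \<open>Among the neighbours of \<open>y\<close> only \<open>x\<close> contributes:
    \<open>no_triangle\<close> rules out height 3, so the others have height 0.\<close>
  have "(\<Sum>z\<in>neighbours G y. w {y, z} * potential z)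
      = (\<Sum>z\<in>neighbours G y. if z = x then 2 * w {x, y} else 0)"
    using not_in_neighbours[OF simple, of y] distinct_ends no_triangle
    by (intro sum.cong) (auto simp: potential_def insert_commute)
  also have "\<dots> = 2 * w {x, y}" using edge fin by simp
  finally have sum_y: "(\<Sum>z\<in>neighbours G y. w {y, z} * potential z) / wdeg G w y = 2 * q"
    by (simp add: q_def)
  \<comment> \<open>For \<open>\<alpha>\<close> above one half, the mass of the first measure at
    \<open>y\<close> is at most \<open>1 - \<alpha>\<close>, below the mass \<open>\<alpha>\<close>
    of the second, as \<open>coupling_fixing_point\<close> demands. The quotient is then constant in
    \<open>\<alpha>\<close>.\<close>
  have W: "alpha_curvature G w \<alpha> x y / (1 - \<alpha>) = 2 * (p + q - 1)"
    if \<alpha>: "1 / 2 < \<alpha>" "\<alpha> < 1" for \<alpha>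
  proof -
    let ?\<mu> = "walk_pmf G w \<alpha> x" and ?\<nu> = "walk_pmf G w \<alpha> y"
    have \<alpha>': "0 \<le> \<alpha>" "\<alpha> \<le> 1" using \<alpha> by auto
    note facts_x = simple lf w \<alpha>' edge(1) and facts_y = simple lf w \<alpha>' edge(2)
    have supp: "set_pmf ?\<mu> \<subseteq> insert x (neighbours G x)" "set_pmf ?\<nu> \<subseteq> insert y (neighbours G y)"
      using set_walk_pmf[OF facts_x] set_walk_pmf[OF facts_y] by auto
    have "pmf ?\<mu> y = (1 - \<alpha>) * p" "pmf ?\<nu> y = \<alpha>"
      using distinct_ends edge
      by (simp_all add: pmf_walk_pmf[OF facts_x] pmf_walk_pmf[OF facts_y] p_def)
    moreover have "(1 - \<alpha>) * p \<le> 1 - \<alpha>" using p \<alpha> by (simp add: mult_left_le)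
    ultimately have "pmf ?\<mu> y \<le> pmf ?\<nu> y" "pmf ?\<mu> y < 1" using \<alpha> by linarith+
    then obtain \<pi> where \<pi>: "\<pi> \<in> couplings ?\<mu> ?\<nu>" and fix_y: "\<And>v. (y, v) \<in> set_pmf \<pi> \<Longrightarrow> v = y"
      by (rule coupling_fixing_point) (rule that)
    have "wasserstein1 G ?\<mu> ?\<nu>
        = measure_pmf.expectation ?\<mu> potential - measure_pmf.expectation ?\<nu> potential"
    proof (rule wasserstein1_eqI[OF _ _ _ \<pi>])
      show "finite (set_pmf ?\<mu>)" "finite (set_pmf ?\<nu>)"
        using supp fin by (meson finite.insertI finite_subset)+
      show "potential u - potential v \<le> graph_dist G u v"
        if "u \<in> set_pmf ?\<mu>" "v \<in> set_pmf ?\<nu>" for u v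
      \<comment> \<open>The pair where equality fails still satisfies the one-sided bound, since the
        potential difference is negative there.\<close>
      proof (cases "u = y \<and> v = x")
        case True
        then show ?thesis using distinct_ends by (simp add: potential_def)
      next
        case False
        moreover have "u \<in> insert x (neighbours G x)" "v \<in> insert y (neighbours G y)"
          using that supp by blast+
        ultimately have "graph_dist G u v = potential u - potential v"
          by (intro graph_dist_eq_potential_diff) blast+
        then show ?thesis by simp
      qed
      show "graph_dist G u v = potential u - potential v" if "(u, v) \<in> set_pmf \<pi>" for u v
      proof (rule graph_dist_eq_potential_diff)
        show "u \<in> insert x (neighbours G x)" "v \<in> insert y (neighbours G y)"
          using set_pmf_coupling[OF \<pi>] supp that by blast+
        show "v \<noteq> x" if "u = y"
          using fix_y \<open>(u, v) \<in> set_pmf \<pi>\<close> that distinct_ends by blast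
      qed
    qed
    also have "measure_pmf.expectation ?\<mu> potential = \<alpha> * 2 + (1 - \<alpha>) * (3 - 2 * p)"
      unfolding expectation_walk_pmf[OF facts_x] times_divide_eq_right[symmetric] sum_x
      by (simp add: potential_def)
    also have "measure_pmf.expectation ?\<nu> potential = \<alpha> + (1 - \<alpha>) * (2 * q)"
      unfolding expectation_walk_pmf[OF facts_y] times_divide_eq_right[symmetric] sum_y
      using distinct_ends by (simp add: potential_def)
    finally show ?thesis
      using \<alpha> unfolding alpha_curvature_def by (simp add: field_simps)
  qed
  \<comment> \<open>The quotient is eventually constant, so the limit exists and \<open>Lim\<close>
    has its intended value.\<close>
  have "\<forall>\<^sub>F \<alpha> in at_left (1::real). 1 / 2 < \<alpha> \<and> \<alpha> < 1"
    using eventually_at_left_real[of "1/2" 1] by (simp add: greaterThanLessThan_iff)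
  then have "((\<lambda>\<alpha>. alpha_curvature G w \<alpha> x y / (1 - \<alpha>)) \<longlongrightarrow> 2 * (p + q - 1)) (at_left 1)"
    by (intro tendsto_eventually) (auto elim!: eventually_mono simp: W)
  then show ?thesis
    unfolding lly_curvature_def p_def q_def by (intro tendsto_Lim) auto
qed

end

section \<open>Subgraphs\<close>

lemma neighbours_mono: "edges H \<subseteq> edges G \<Longrightarrow> neighbours H x \<subseteq> neighbours G x"
  by (auto simp: neighbours_def)

lemma locally_finite_subgraph:
  assumes "subgraph H G" "locally_finite G"
  shows "locally_finite H"
  using assms unfolding subgraph_def locally_finite_def
  by (meson neighbours_mono finite_subset subsetD)

lemma wdeg_mono:
  assumes "edges H \<subseteq> edges G" "positive_weight G w" "finite (neighbours G x)"
  shows "wdeg H w x \<le> wdeg G w x"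
  unfolding wdeg_def using assms neighbours_mono[OF assms(1)]
  by (intro sum_mono2) (auto simp: positive_weight_def neighbours_def less_imp_le)

text \<open>By the explicit formula, the curvature of a tree-like edge depends on the graph only
  through the weighted degrees of its ends. These do not increase in \<open>H\<close>, so both
  fractions can only grow.\<close>

lemma admissible_subgraph:
  assumes G: "simple_graph G" "locally_finite G" and H: "subgraph H G"
    and treelike: "edges H \<subseteq> treelike_edges G" and w: "admissible G w"
  shows "admissible H w"
  unfolding admissible_def
proof (intro conjI allI impI)
  have HG: "edges H \<subseteq> edges G" "simple_graph H" using H by (auto simp: subgraph_def)
  have wG: "positive_weight G w" using w by (simp add: admissible_def)
  then show wH: "positive_weight H w" using HG by (auto simp: positive_weight_def)
  have lf: "locally_finite H" by (rule locally_finite_subgraph[OF H G(2)])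
  fix x y assume xy: "{x, y} \<in> edges H"
  interpret G: treelike_edge G x y
    using G treelike xy by unfold_locales auto
  interpret H: treelike_edge H x y
    using HG treelike xy treelike_edges_subgraph[of H G "{x, y}"] by unfold_locales auto
  have le: "w {x, y} / wdeg G w z \<le> w {x, y} / wdeg H w z" if "v \<in> neighbours H z" for z v
  proof (rule divide_left_mono)
    show "wdeg H w z \<le> wdeg G w z"
      by (rule wdeg_mono[OF HG(1) wG finite_neighbours[OF G]])
    moreover have "0 < wdeg H w z"
      using wdeg_pos[OF wH finite_neighbours[OF HG(2) lf] that] .
    ultimately show "0 < wdeg G w z * wdeg H w z" by simp
    show "0 \<le> w {x, y}" using wH xy by (auto simp: positive_weight_def less_imp_le)
  qed
  have "0 \<le> lly_curvature G w x y" using w xy HG by (auto simp: admissible_def)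
  also have "\<dots> \<le> lly_curvature H w x y"
    unfolding G.lly_curvature_eq[OF G(2) wG] H.lly_curvature_eq[OF lf wH]
    using le[OF H.edge(1)] le[OF H.edge(2)] by simp
  finally show "0 \<le> lly_curvature H w x y" .
qed

section \<open>Monotonicity and lower bound of the distortion\<close>

lemma distortion_mono:
  assumes "edges H \<noteq> {}" "edges H \<subseteq> edges G" "positive_weight G w"
  shows "distortion H w \<le> distortion G w"
proof -
  define S I where SI: "S K = (SUP e\<in>edges K. ereal (w e))" "I K = (INF e\<in>edges K. ereal (w e))"
    for K :: "'a ugraph"
  have D: "distortion K w = (if S K = \<infinity> \<or> I K = 0 then \<infinity> else S K / I K)" for K
    by (simp add: distortion_def SI Let_def)
  have S: "S H \<le> S G" and I: "I G \<le> I H"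
    using assms by (auto simp: SI intro: SUP_subset_mono INF_superset_mono)
  have I0: "0 \<le> I G"
    using assms(3) by (auto simp: SI positive_weight_def intro!: INF_greatest intro: less_imp_le)
  obtain e where e: "e \<in> edges H" using assms(1) by auto
  \<comment> \<open>The finite positive weight of one edge of \<open>H\<close> keeps both extrema
    finite and the supremum positive, so the comparison reduces to real fractions.\<close>
  have IH: "I H \<le> ereal (w e)" and SH: "ereal (w e) \<le> S H"
    using e by (auto simp: SI intro: INF_lower SUP_upper)
  have we: "0 < w e" using e assms by (auto simp: positive_weight_def)
  show ?thesis
  proof (cases "S G = \<infinity> \<or> I G = 0")
    case False
    obtain a b c d where r: "S G = ereal a" "S H = ereal b" "I G = ereal c" "I H = ereal d"
      using False S I I0 IH SH by (cases "S G"; cases "S H"; cases "I G"; cases "I H") auto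
    have "0 < c" "c \<le> d" "0 < b" "b \<le> a" using False S I I0 SH we by (auto simp: r)
    then have "b / d \<le> a / c" by (intro frac_le) auto
    then show ?thesis using \<open>0 < c\<close> \<open>c \<le> d\<close> by (auto simp: D r)
  qed (auto simp: D)
qed

text \<open>Deleting all edges but one leaves distortion exactly one, and deletion cannot increase
  it. This handles the conventional value 1 of an edgeless \<open>H\<close>.\<close>

lemma one_le_distortion:
  assumes "edges G \<noteq> {}" "positive_weight G w"
  shows "1 \<le> distortion G w"
proof -
  obtain e where e: "e \<in> edges G" using assms(1) by auto
  then have "distortion (G\<lparr>edges := {e}\<rparr>) w \<le> distortion G w"
    using assms(2) by (intro distortion_mono) auto
  moreover have "distortion (G\<lparr>edges := {e}\<rparr>) w = 1"
    using e assms(2) by (auto simp: distortion_def positive_weight_def)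
  ultimately show ?thesis by simp
qed

theorem theorem1p8:
  fixes G H :: "'a ugraph"
  assumes "simple_graph G" and "connected_graph G" and "locally_finite G"
    and "subgraph H G" and "connected_graph H"
    and "edges H \<subseteq> treelike_edges G"
  shows "DN_LLY H \<le> DN_LLY G"
proof (cases "edges H = {}")
  case True
  then show ?thesis
    by (auto simp: DN_LLY_def admissible_def intro!: Inf_greatest one_le_distortion)
next
  case False
  have HG: "edges H \<subseteq> edges G" using assms(4) by (simp add: subgraph_def)
  \<comment> \<open>Each admissible weight on \<open>G\<close> is itself a competitor on
    \<open>H\<close>. If \<open>G\<close> has none, its infimum is infinite and the bound is
    trivial.\<close>
  have "Inf {distortion H w | w. admissible H w} \<le> distortion G w" if w: "admissible G w" for w
  proof -
    have "Inf {distortion H w | w. admissible H w} \<le> distortion H w"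
      using admissible_subgraph[OF assms(1,3,4,6) w] by (auto intro: Inf_lower)
    also have "\<dots> \<le> distortion G w"
      using w by (intro distortion_mono[OF False HG]) (simp add: admissible_def)
    finally show ?thesis .
  qed
  then show ?thesis
    using False HG by (auto simp: DN_LLY_def intro!: Inf_greatest)
qed

end
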